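(* Let $X=\{x_1,\dots,x_n\}$ be a finite universe of discourse and let $\omega=(\omega_1,\dots,\omega_n)^{\top}$ be a weight vector with $\omega_j\in(0,1]$ for all $j$ and $\sum_{j=1}^n\omega_j=1$. For $I_1,I_2\in\mathrm{IFS}(X)$ define $$d(I_1,I_2)=\sum_{j=1}^n\omega_j\,\varrho(I_1(x_j),I_2(x_j)),\qquad \mathbf{S}(I_1,I_2)=1-\sum_{j=1}^n\omega_j\,\varrho(I_1(x_j),I_2(x_j)).$$ Then: (1) The function $d$ is a metric on $\mathrm{IFS}(X)$. (2) The function $\mathbf{S}$ is an admissible similarity measure with the order $\leq_{\mathrm{XY}}$ on $\mathrm{IFS}(X)$.
   Context: $\tilde{\mathbb{I}}=\{\langle\mu,\nu\rangle\in[0,1]^2 \mid \mu+\nu\le 1\}$ is the set of intuitionistic fuzzy values. For $\alpha=\langle\mu_\alpha,\nu_\alpha\rangle\in\tilde{\mathbb{I}}$ put $s(\alpha)=\mu_\alpha-\nu_\alpha$ and $h(\alpha)=\mu_\alpha+\nu_\alpha$. Define $\alpha<_{\mathrm{XY}}\beta$ iff $s(\alpha)<s(\beta)$, or $s(\alpha)=s(\beta)$ and $h(\alpha)<h(\beta)$; $\alpha\leq_{\mathrm{XY}}\beta$ iff $\alpha<_{\mathrm{XY}}\beta$ or $\alpha=\beta$. An intuitionistic fuzzy set $I$ on $X$ is given by functions $\mu_I,\nu_I:X\to[0,1]$ with $\mu_I(x)+\nu_I(x)\le 1$ for all $x\in X$; equivalently it is a map $I:X\to\tilde{\mathbb{I}}$,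 $I(x)=\langle\mu_I(x),\nu_I(x)\rangle$. $\mathrm{IFS}(X)$ is the set of all of them. For $I_1,I_2\in\mathrm{IFS}(X)$, $I_1\leq_{\mathrm{XY}}I_2$ means $I_1(x)\leq_{\mathrm{XY}}I_2(x)$ for all $x\in X$. For $\alpha,\beta\in\tilde{\mathbb{I}}$, $$\varrho(\alpha,\beta)=\begin{cases}\frac13\left(1+|s(\alpha)-s(\beta)|\right), & s(\alpha)\ne s(\beta),\\ \frac13|h(\alpha)-h(\beta)|, & s(\alpha)=s(\beta).\end{cases}$$ A mapping $\mathbf{S}:\mathrm{IFS}(X)\times\mathrm{IFS}(X)\to[0,1]$ is an admissible similarity measure with the order $\leq_{\mathrm{XY}}$ on $\mathrm{IFS}(X)$ if for all $I_1,I_2,I_3\in\mathrm{IFS}(X)$: (1) $0\le\mathbf{S}(I_1,I_2)\le1$; (2) $\mathbf{S}(I_1,I_2)=1$ iff $I_1=I_2$; (3) $\mathbf{S}(I_1,I_2)=\mathbf{S}(I_2,I_1)$; (4$'$) if $I_1\leq_{\mathrm{XY}}I_2\leq_{\mathrm{XY}}I_3$, then $\mathbf{S}(I_1,I_3)\le\mathbf{S}(I_1,I_2)$ and $\mathbf{S}(I_1,I_3)\le\mathbf{S}(I_2,I_3)$. *)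

theory Defs
  imports "HOL-Analysis.Analysis"
begin

text \<open>An intuitionistic fuzzy value \<open>\<langle>\<mu>, \<nu>\<rangle>\<close> is encoded as the pair \<open>(\<mu>, \<nu>)\<close> of reals.\<close>

definition IFV :: "(real \<times> real) set" where
  "IFV = {(\<mu>, \<nu>). \<mu> \<in> {0..1} \<and> \<nu> \<in> {0..1} \<and> \<mu> + \<nu> \<le> 1}"

definition score :: "real \<times> real \<Rightarrow> real" where
  "score \<alpha> = fst \<alpha> - snd \<alpha>"

definition accuracy :: "real \<times> real \<Rightarrow> real" where
  "accuracy \<alpha> = fst \<alpha> + snd \<alpha>"

definition less_XY :: "real \<times> real \<Rightarrow> real \<times> real \<Rightarrow> bool" where
  "less_XY \<alpha> \<beta> \<longleftrightarrow>
     score \<alpha> < score \<beta> \<or> (score \<alpha> = score \<beta> \<and> accuracy \<alpha> < accuracy \<beta>)"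

definition le_XY :: "real \<times> real \<Rightarrow> real \<times> real \<Rightarrow> bool" where
  "le_XY \<alpha> \<beta> \<longleftrightarrow> less_XY \<alpha> \<beta> \<or> \<alpha> = \<beta>"

text \<open>Extensional functions are used so that equality of two fuzzy sets in \<open>IFS X\<close> is
  equality as maps on \<open>X\<close>.\<close>

definition IFS :: "'a set \<Rightarrow> ('a \<Rightarrow> real \<times> real) set" where
  "IFS X = X \<rightarrow>\<^sub>E IFV"

definition IFS_le_XY ::
    "'a set \<Rightarrow> ('a \<Rightarrow> real \<times> real) \<Rightarrow> ('a \<Rightarrow> real \<times> real) \<Rightarrow> bool" where
  "IFS_le_XY X I1 I2 \<longleftrightarrow> (\<forall>x\<in>X. le_XY (I1 x) (I2 x))"

definition rho :: "real \<times> real \<Rightarrow> real \<times> real \<Rightarrow> real" where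
  "rho \<alpha> \<beta> =
     (if score \<alpha> \<noteq> score \<beta> then 1 / 3 * (1 + \<bar>score \<alpha> - score \<beta>\<bar>)
      else 1 / 3 * \<bar>accuracy \<alpha> - accuracy \<beta>\<bar>)"

definition admissible_similarity_XY ::
    "'a set \<Rightarrow> (('a \<Rightarrow> real \<times> real) \<Rightarrow> ('a \<Rightarrow> real \<times> real) \<Rightarrow> real) \<Rightarrow> bool" where
  "admissible_similarity_XY X S \<longleftrightarrow>
     (\<forall>I1\<in>IFS X. \<forall>I2\<in>IFS X. 0 \<le> S I1 I2 \<and> S I1 I2 \<le> 1) \<and>
     (\<forall>I1\<in>IFS X. \<forall>I2\<in>IFS X. S I1 I2 = 1 \<longleftrightarrow> I1 = I2) \<and>
     (\<forall>I1\<in>IFS X. \<forall>I2\<in>IFS X. S I1 I2 = S I2 I1) \<and>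
     (\<forall>I1\<in>IFS X. \<forall>I2\<in>IFS X. \<forall>I3\<in>IFS X.
        IFS_le_XY X I1 I2 \<and> IFS_le_XY X I2 I3 \<longrightarrow>
        S I1 I3 \<le> S I1 I2 \<and> S I1 I3 \<le> S I2 I3)"

end

theory Submission
  imports Defs
begin

text \<open>Scores differ by at most 2 and accuracies by at most 1 on \<open>IFV\<close>. Hence \<open>rho\<close> takes values
  at most 1/3 between values of equal score and between 1/3 and 1 otherwise; the offset 1/3 is what
  makes both the triangle inequality and monotonicity along the lexicographic order hold when equal
  and distinct scores are mixed. Weighted sums with positive weights inherit these properties
  coordinatewise.\<close>

lemma IFV_score_bounds: "\<alpha> \<in> IFV \<Longrightarrow> \<bar>score \<alpha>\<bar> \<le> 1"
  by (auto simp: IFV_def score_def)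

lemma IFV_accuracy_bounds: "\<alpha> \<in> IFV \<Longrightarrow> 0 \<le> accuracy \<alpha> \<and> accuracy \<alpha> \<le> 1"
  by (auto simp: IFV_def accuracy_def)

text \<open>The linear map (\<mu>, \<nu>) to (\<mu> - \<nu>, \<mu> + \<nu>) has determinant 2, hence
  is injective.\<close>

lemma score_accuracy_eqI: "score \<alpha> = score \<beta> \<Longrightarrow> accuracy \<alpha> = accuracy \<beta> \<Longrightarrow> \<alpha> = \<beta>"
  by (simp add: score_def accuracy_def prod_eq_iff)

lemma rho_nonneg: "0 \<le> rho \<alpha> \<beta>"
  by (simp add: rho_def)

lemma rho_commute: "rho \<alpha> \<beta> = rho \<beta> \<alpha>"
  by (auto simp: rho_def)

lemma rho_eq_0_iff: "rho \<alpha> \<beta> = 0 \<longleftrightarrow> \<alpha> = \<beta>"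
  by (auto simp: rho_def intro: score_accuracy_eqI)

text \<open>Clearing the factor 1/3 turns the bounds on \<open>rho\<close> below into linear case
  analyses on scores and accuracies.\<close>

lemma three_rho:
  "3 * rho \<alpha> \<beta> =
     (if score \<alpha> = score \<beta> then \<bar>accuracy \<alpha> - accuracy \<beta>\<bar> else 1 + \<bar>score \<alpha> - score \<beta>\<bar>)"
  by (simp add: rho_def)

lemma rho_le_1:
  assumes "\<alpha> \<in> IFV" "\<beta> \<in> IFV"
  shows "rho \<alpha> \<beta> \<le> 1"
  using assms[THEN IFV_score_bounds] assms[THEN IFV_accuracy_bounds]
    three_rho[of \<alpha> \<beta>]
  by (smt (verit))

text \<open>Multiply by 3. If the scores of \<alpha> and \<gamma> differ, some leg through \<beta>
  changes score: a single such leg carries the whole score difference, and two of them pay the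
  offset twice. If they agree, either \<beta> shares their score and the accuracies decide, or both
  legs exceed 1, which bounds the accuracy difference.\<close>

lemma rho_triangle:
  assumes "\<alpha> \<in> IFV" "\<beta> \<in> IFV" "\<gamma> \<in> IFV"
  shows "rho \<alpha> \<gamma> \<le> rho \<alpha> \<beta> + rho \<beta> \<gamma>"
  using assms[THEN IFV_accuracy_bounds]
    three_rho[of \<alpha> \<beta>] three_rho[of \<beta> \<gamma>] three_rho[of \<alpha> \<gamma>]
  by (smt (verit))

lemma le_XY_iff:
  "le_XY \<alpha> \<beta> \<longleftrightarrow> score \<alpha> < score \<beta> \<or> score \<alpha> = score \<beta> \<and> accuracy \<alpha> \<le> accuracy \<beta>"
  by (auto simp: le_XY_def less_XY_def dest: score_accuracy_eqI)

text \<open>Scores increase weakly along the chain. If the outer scores agree, all three do and the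
  accuracies are ordered. Otherwise 3 times the outer \<open>rho\<close> exceeds 1, which dominates
  any leg of constant score, while a leg that changes score has at most the outer score
  difference.\<close>

lemma rho_mono_le_XY:
  assumes "\<alpha> \<in> IFV" "\<beta> \<in> IFV" "\<gamma> \<in> IFV" and "le_XY \<alpha> \<beta>" "le_XY \<beta> \<gamma>"
  shows "rho \<alpha> \<beta> \<le> rho \<alpha> \<gamma>" and "rho \<beta> \<gamma> \<le> rho \<alpha> \<gamma>"
  using assms(1-3)[THEN IFV_accuracy_bounds] assms(4,5)[unfolded le_XY_iff]
    three_rho[of \<alpha> \<beta>] three_rho[of \<beta> \<gamma>] three_rho[of \<alpha> \<gamma>]
  by (smt (verit))+

theorem theorem7p1:
  fixes X :: "'a set" and n :: nat and x :: "nat \<Rightarrow> 'a" and \<omega> :: "nat \<Rightarrow> real"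
  assumes "bij_betw x {1..n} X"
    and "\<forall>j\<in>{1..n}. \<omega> j \<in> {0<..1}"
    and "(\<Sum>j=1..n. \<omega> j) = 1"
  shows "Metric_space (IFS X) (\<lambda>I1 I2. \<Sum>j=1..n. \<omega> j * rho (I1 (x j)) (I2 (x j))) \<and>
         admissible_similarity_XY X (\<lambda>I1 I2. 1 - (\<Sum>j=1..n. \<omega> j * rho (I1 (x j)) (I2 (x j))))"
proof -
  define d where "d = (\<lambda>I1 I2. \<Sum>j=1..n. \<omega> j * rho (I1 (x j)) (I2 (x j)))"
  have X: "X = x ` {1..n}"
    using assms(1) by (simp add: bij_betw_def)
  have pos: "0 < \<omega> j" if "j \<in> {1..n}" for j
    using assms(2) that by auto
  have IFV: "I (x j) \<in> IFV" if "I \<in> IFS X" "j \<in> {1..n}" for I j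
    using that by (auto simp: IFS_def X)
  have sum_mono_weighted: "(\<Sum>j=1..n. \<omega> j * f j) \<le> (\<Sum>j=1..n. \<omega> j * g j)"
    if "\<And>j. j \<in> {1..n} \<Longrightarrow> f j \<le> g j" for f g
    using that pos by (intro sum_mono mult_left_mono) (auto intro: less_imp_le)
  have nonneg: "0 \<le> d I1 I2" for I1 I2
    unfolding d_def using pos by (intro sum_nonneg mult_nonneg_nonneg rho_nonneg less_imp_le)
  have comm: "d I1 I2 = d I2 I1" for I1 I2
    by (simp add: d_def rho_commute)
  \<comment> \<open>The weights sum to 1, so comparing with the constant 1 bounds \<open>d\<close>
    by 1.\<close>
  have le_1: "d I1 I2 \<le> 1" if "I1 \<in> IFS X" "I2 \<in> IFS X" for I1 I2
    using sum_mono_weighted[of "\<lambda>j. rho (I1 (x j)) (I2 (x j))" "\<lambda>j. 1"] IFV that assms(3)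
    by (simp add: d_def rho_le_1)
  have zero: "d I1 I2 = 0 \<longleftrightarrow> I1 = I2" if "I1 \<in> IFS X" "I2 \<in> IFS X" for I1 I2
  proof -
    have "d I1 I2 = 0 \<longleftrightarrow> (\<forall>j\<in>{1..n}. \<omega> j * rho (I1 (x j)) (I2 (x j)) = 0)"
      unfolding d_def using pos
      by (intro sum_nonneg_eq_0_iff mult_nonneg_nonneg rho_nonneg less_imp_le) auto
    \<comment> \<open>Strict positivity of the weights allows them to be cancelled; a zero weight
      would hide a coordinate.\<close>
    also have "\<dots> \<longleftrightarrow> (\<forall>j\<in>{1..n}. I1 (x j) = I2 (x j))"
      using pos by (intro ball_cong refl) (simp add: rho_eq_0_iff less_imp_neq[symmetric])
    also have "\<dots> \<longleftrightarrow> (\<forall>y\<in>X. I1 y = I2 y)"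
      by (simp add: X)
    \<comment> \<open>Members of \<open>IFS X\<close> are extensional, so they coincide outside
      \<open>X\<close> and agreement on \<open>X\<close> is equality.\<close>
    also have "\<dots> \<longleftrightarrow> I1 = I2"
      using that unfolding IFS_def by (auto intro: PiE_ext)
    finally show ?thesis .
  qed
  have triangle: "d I1 I3 \<le> d I1 I2 + d I2 I3"
    if "I1 \<in> IFS X" "I2 \<in> IFS X" "I3 \<in> IFS X" for I1 I2 I3
  proof -
    have "d I1 I3 \<le> (\<Sum>j=1..n. \<omega> j * (rho (I1 (x j)) (I2 (x j)) + rho (I2 (x j)) (I3 (x j))))"
      unfolding d_def using IFV that by (intro sum_mono_weighted rho_triangle)
    then show ?thesis
      by (simp add: d_def distrib_left sum.distrib)
  qed
  have mono: "d I1 I2 \<le> d I1 I3" "d I2 I3 \<le> d I1 I3"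
    if "I1 \<in> IFS X" "I2 \<in> IFS X" "I3 \<in> IFS X" "IFS_le_XY X I1 I2" "IFS_le_XY X I2 I3"
    for I1 I2 I3
  proof -
    have le: "le_XY (I1 (x j)) (I2 (x j))" "le_XY (I2 (x j)) (I3 (x j))" if "j \<in> {1..n}" for j
      using \<open>IFS_le_XY X I1 I2\<close> \<open>IFS_le_XY X I2 I3\<close> that by (auto simp: IFS_le_XY_def X)
    note vals = IFV[OF that(1)] IFV[OF that(2)] IFV[OF that(3)]
    show "d I1 I2 \<le> d I1 I3"
      unfolding d_def by (rule sum_mono_weighted, rule rho_mono_le_XY(1)[OF vals le])
    show "d I2 I3 \<le> d I1 I3"
      unfolding d_def by (rule sum_mono_weighted, rule rho_mono_le_XY(2)[OF vals le])
  qed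
  have "Metric_space (IFS X) d"
    by (rule Metric_space.intro) (fact nonneg comm zero triangle)+
  moreover have "admissible_similarity_XY X (\<lambda>I1 I2. 1 - d I1 I2)"
    unfolding admissible_similarity_XY_def
  \<comment> \<open>Under \<open>1 - d\<close>, zero distance becomes similarity 1 and the
    monotonicity of \<open>d\<close> along chains is reversed.\<close>
  proof (intro conjI ballI impI)
    fix I1 I2 assume I: "I1 \<in> IFS X" "I2 \<in> IFS X"
    show "0 \<le> 1 - d I1 I2" "1 - d I1 I2 \<le> 1"
      using le_1[OF I] nonneg by simp_all
    show "1 - d I1 I2 = 1 \<longleftrightarrow> I1 = I2"
      using zero[OF I] by simp
    show "1 - d I1 I2 = 1 - d I2 I1"
      using comm[of I1 I2] by simp
  next
    fix I1 I2 I3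
    assume I: "I1 \<in> IFS X" "I2 \<in> IFS X" "I3 \<in> IFS X"
      and le: "IFS_le_XY X I1 I2 \<and> IFS_le_XY X I2 I3"
    show "1 - d I1 I3 \<le> 1 - d I1 I2" "1 - d I1 I3 \<le> 1 - d I2 I3"
      using mono[OF I] le by simp_all
  qed
  ultimately show ?thesis
    unfolding d_def by blast
qed

end
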